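(* Let $(Z^{i,j},d^{i,j},S^{i,j},K^{i,j})$, $0\le i\le n$, $0\le j\le N$, be data as described in the context, i.e. each row $(Z^{\bullet,j},d^{\bullet,j})$ is a complex of Hilbert spaces with bounded linear differentials, and $K^{i,j}:Z^{i,j}\to Z^{i,j-1}$ and $S^{i,j}:Z^{i,j}\to Z^{i+1,j-1}$ are linear operators. Assume that for all $i,j$ $$S^{i,j-1}K^{i,j}=K^{i+1,j-1}S^{i,j},\qquad S^{i,j}=d^{i,j-1}K^{i,j}-K^{i+1,j}d^{i,j},$$ and that all the operators $K^{i,j}$ and $S^{i,j}$ are bounded. Then the operators $F^i:=\exp(K^i):Z^i\to Z^i$ are bounded and induce an isomorphism between the complex $(Z^\bullet,d^\bullet)$ and the twisted complex $(Z^\bullet,d_V^\bullet)$ (that is, each $F^i$ is an isomorphism and $F^{i+1}d^i=d_V^iF^i$ for all $i$). Hence for the cohomology of the twisted complex, for every $k$, $$\mathcal{H}^k(Z^\bullet,d_V^\bullet)\cong\bigoplus_{j=0}^N\mathcal{H}^k(Z^{\bullet,j},d^{\bullet,j}).$$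
   Context: $Z^{i,j}$ ($0\le i\le n$, $0\le j\le N$) are Hilbert spaces and $d^{i,j}:Z^{i,j}\to Z^{i+1,j}$ are bounded linear operators with $d^{i+1,j}\circ d^{i,j}=0$. Linear operators $K^{i,j}:Z^{i,j}\to Z^{i,j-1}$ and $S^{i,j}:Z^{i,j}\to Z^{i+1,j-1}$ are given; spaces with indices outside the range $0\le i\le n$, $0\le j\le N$, and operators from or into them, are understood to be zero. Set $Z^i:=Z^{i,0}\oplus Z^{i,1}\oplus\dots\oplus Z^{i,N}$. The operators are collected into $d^i:Z^i\to Z^{i+1}$, $(d^i\phi)_j=d^{i,j}\phi_j$; $K^i:Z^i\to Z^i$, $(K^i\phi)_j=K^{i,j+1}\phi_{j+1}$; and $S^i:Z^i\to Z^{i+1}$, $(S^i\phi)_j=S^{i,j+1}\phi_{j+1}$ (with $\phi_{N+1}=0$). The twisted operator is $d_V^i:=d^i-S^i:Z^i\to Z^{i+1}$; under the assumptions of the theorem $d_V^{i+1}\circ d_V^i=0$, and $(Z^\bullet,d_V^\bullet)$ is called the twisted complex. Since $(K^i)^{N+1}=0$, the exponential $\exp(K^i)=\sum_{m\ge0}\frac{1}{m!}(K^i)^m$ is a finite sum. $\mathcal{H}^k(X^\bullet,d^\bullet)=\ker(d^k)/\operatorname{ran}(d^{k-1})$ denotes the cohomology of a complex at index $k$. *)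

theory Defs
  imports "HOL-Analysis.Analysis" "HOL-Library.Function_Algebras"
begin

text \<open>
  The Hilbert spaces are closed subspaces of one ambient Hilbert space; a family of Hilbert spaces
  always embeds isometrically in this way, into its orthogonal sum. Indices are integers, so that
  the spaces with indices out of range are literally zero spaces and no case distinctions are
  needed at the boundary.
\<close>

text \<open>
  Scalar multiplication of a real or complex Hilbert space. A field of class
  \<open>real_normed_field\<close> is isometrically isomorphic to the reals or the complex numbers. For complex
  scalars, \<open>\<bullet>\<close> is the real part of the Hermitian inner product, which is recovered from the
  norm by polarization; \<open>norm\<close> is the Hilbert norm in both cases.
\<close>

definition hilbert_scale ::
    "('k::real_normed_field \<Rightarrow> 'a::{real_inner,complete_space} \<Rightarrow> 'a) \<Rightarrow> bool" where
  "hilbert_scale scl \<longleftrightarrow>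
     vector_space scl \<and>
     (\<forall>r x. scl (of_real r) x = r *\<^sub>R x) \<and>
     (\<forall>c x. norm (scl c x) = norm c * norm x)"

definition hilbert_subspace ::
    "('k::real_normed_field \<Rightarrow> 'a::{real_inner,complete_space} \<Rightarrow> 'a) \<Rightarrow> 'a set \<Rightarrow> bool" where
  "hilbert_subspace scl X \<longleftrightarrow> module.subspace scl X \<and> closed X"

text \<open>
  Operators are only constrained on their domain \<open>X\<close>. The norm is a parameter because the
  notion is used both in the ambient space and for the direct sums below.
\<close>

definition bounded_linear_op ::
    "('k \<Rightarrow> 'v \<Rightarrow> 'v) \<Rightarrow> ('v \<Rightarrow> real) \<Rightarrow> 'v set \<Rightarrow> 'v set \<Rightarrow> ('v::ab_group_add \<Rightarrow> 'v) \<Rightarrow> bool" where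
  "bounded_linear_op scl nrm X Y f \<longleftrightarrow>
     f \<in> X \<rightarrow> Y \<and>
     (\<forall>x\<in>X. \<forall>y\<in>X. f (x + y) = f x + f y) \<and>
     (\<forall>c. \<forall>x\<in>X. f (scl c x) = scl c (f x)) \<and>
     (\<exists>B. \<forall>x\<in>X. nrm (f x) \<le> B * nrm x)"

definition bounded_complex ::
    "('k \<Rightarrow> 'v \<Rightarrow> 'v) \<Rightarrow> ('v \<Rightarrow> real) \<Rightarrow> (int \<Rightarrow> 'v set) \<Rightarrow> (int \<Rightarrow> 'v::ab_group_add \<Rightarrow> 'v) \<Rightarrow> bool" where
  "bounded_complex scl nrm X D \<longleftrightarrow>
     (\<forall>i. bounded_linear_op scl nrm (X i) (X (i + 1)) (D i)) \<and>
     (\<forall>i. \<forall>x\<in>X i. D (i + 1) (D i x) = 0)"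

definition bounded_complex_iso ::
    "('k \<Rightarrow> 'v \<Rightarrow> 'v) \<Rightarrow> ('v \<Rightarrow> real) \<Rightarrow> (int \<Rightarrow> 'v set) \<Rightarrow> (int \<Rightarrow> 'v::ab_group_add \<Rightarrow> 'v) \<Rightarrow>
     (int \<Rightarrow> 'v \<Rightarrow> 'v) \<Rightarrow> (int \<Rightarrow> 'v \<Rightarrow> 'v) \<Rightarrow> bool" where
  "bounded_complex_iso scl nrm X D D' F \<longleftrightarrow>
     (\<forall>i. bounded_linear_op scl nrm (X i) (X i) (F i) \<and>
          bij_betw (F i) (X i) (X i) \<and>
          bounded_linear_op scl nrm (X i) (X i) (inv_into (X i) (F i))) \<and>
     (\<forall>i. \<forall>x\<in>X i. F (i + 1) (D i x) = D' i (F i x))"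

definition sum_space :: "nat \<Rightarrow> (int \<Rightarrow> int \<Rightarrow> 'a::zero set) \<Rightarrow> int \<Rightarrow> (int \<Rightarrow> 'a) set" where
  "sum_space N Z i =
     {\<phi>. (\<forall>j\<in>{0..int N}. \<phi> j \<in> Z i j) \<and> (\<forall>j. j \<notin> {0..int N} \<longrightarrow> \<phi> j = 0)}"

definition sum_norm :: "nat \<Rightarrow> (int \<Rightarrow> 'a::real_normed_vector) \<Rightarrow> real" where
  "sum_norm N \<phi> = L2_set (\<lambda>j. norm (\<phi> j)) {0..int N}"

definition sum_scale :: "('k \<Rightarrow> 'a \<Rightarrow> 'a) \<Rightarrow> 'k \<Rightarrow> (int \<Rightarrow> 'a) \<Rightarrow> int \<Rightarrow> 'a" where
  "sum_scale scl c \<phi> = (\<lambda>j. scl c (\<phi> j))"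

definition diag_op :: "(int \<Rightarrow> int \<Rightarrow> 'a \<Rightarrow> 'a) \<Rightarrow> int \<Rightarrow> (int \<Rightarrow> 'a) \<Rightarrow> int \<Rightarrow> 'a" where
  "diag_op d i \<phi> = (\<lambda>j. d i j (\<phi> j))"

definition shift_op :: "(int \<Rightarrow> int \<Rightarrow> 'a \<Rightarrow> 'a) \<Rightarrow> int \<Rightarrow> (int \<Rightarrow> 'a) \<Rightarrow> int \<Rightarrow> 'a" where
  "shift_op K i \<phi> = (\<lambda>j. K i (j + 1) (\<phi> (j + 1)))"

definition twisted_op ::
    "(int \<Rightarrow> int \<Rightarrow> 'a \<Rightarrow> 'a) \<Rightarrow> (int \<Rightarrow> int \<Rightarrow> 'a \<Rightarrow> 'a) \<Rightarrow> int \<Rightarrow> (int \<Rightarrow> 'a::ab_group_add) \<Rightarrow> int \<Rightarrow> 'a" where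
  "twisted_op d S i \<phi> = diag_op d i \<phi> - shift_op S i \<phi>"

definition exp_op :: "((int \<Rightarrow> 'a) \<Rightarrow> int \<Rightarrow> 'a) \<Rightarrow> (int \<Rightarrow> 'a::real_normed_vector) \<Rightarrow> int \<Rightarrow> 'a" where
  "exp_op T \<phi> = (\<lambda>j. \<Sum>m. (1 / fact m) *\<^sub>R (T ^^ m) \<phi> j)"

text \<open>
  Quotients and sums of quotients do not live in a type with a vector space structure,
  so they carry their operations explicitly.
\<close>

record ('k, 'v) vspace =
  vs_carrier :: "'v set"
  vs_add :: "'v \<Rightarrow> 'v \<Rightarrow> 'v"
  vs_scale :: "'k \<Rightarrow> 'v \<Rightarrow> 'v"

definition vs_isomorphic :: "('k, 'v) vspace \<Rightarrow> ('k, 'w) vspace \<Rightarrow> bool" where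
  "vs_isomorphic V W \<longleftrightarrow>
     (\<exists>f. bij_betw f (vs_carrier V) (vs_carrier W) \<and>
          (\<forall>x\<in>vs_carrier V. \<forall>y\<in>vs_carrier V. f (vs_add V x y) = vs_add W (f x) (f y)) \<and>
          (\<forall>c. \<forall>x\<in>vs_carrier V. f (vs_scale V c x) = vs_scale W c (f x)))"

text \<open>
  In \<open>vs_scale\<close>, adding \<open>U\<close> matters only for \<open>c = 0\<close>, where the multiple has to be the
  coset \<open>U\<close> and not \<open>{0}\<close>.
\<close>

definition quotient_vspace ::
    "('k \<Rightarrow> 'v \<Rightarrow> 'v) \<Rightarrow> 'v set \<Rightarrow> 'v::ab_group_add set \<Rightarrow> ('k, 'v set) vspace" where
  "quotient_vspace scl X U =
     \<lparr>vs_carrier = {{x + u | u. u \<in> U} | x. x \<in> X},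
      vs_add = (\<lambda>A B. {a + b | a b. a \<in> A \<and> b \<in> B}),
      vs_scale = (\<lambda>c A. {scl c a + u | a u. a \<in> A \<and> u \<in> U})\<rparr>"

definition cohomology ::
    "('k \<Rightarrow> 'v \<Rightarrow> 'v) \<Rightarrow> (int \<Rightarrow> 'v set) \<Rightarrow> (int \<Rightarrow> 'v::ab_group_add \<Rightarrow> 'v) \<Rightarrow> int \<Rightarrow> ('k, 'v set) vspace" where
  "cohomology scl X D k =
     quotient_vspace scl {x \<in> X k. D k x = 0} (D (k - 1) ` X (k - 1))"

definition direct_sum_vspace ::
    "int set \<Rightarrow> (int \<Rightarrow> ('k, 'v) vspace) \<Rightarrow> ('k, int \<Rightarrow> 'v) vspace" where
  "direct_sum_vspace J V =
     \<lparr>vs_carrier = (\<Pi>\<^sub>E j\<in>J. vs_carrier (V j)),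
      vs_add = (\<lambda>f g. \<lambda>j\<in>J. vs_add (V j) (f j) (g j)),
      vs_scale = (\<lambda>c f. \<lambda>j\<in>J. vs_scale (V j) c (f j))\<rparr>"

end

theory Submission imports Defs begin

text \<open>
  On the direct sums, the hypotheses say that \<open>S\<close> is the commutator of \<open>d\<close> and \<open>K\<close>, and that \<open>S\<close>
  commutes with \<open>K\<close>. Commuting \<open>d\<close> past the factors of \<open>K\<^sup>m\<close> one at a time therefore produces \<open>m\<close>
  equal terms: \<open>d K\<^sup>m = K\<^sup>m d + m S K\<^sup>m\<^sup>-\<^sup>1\<close> (\<open>commutator_funpow\<close>). Dividing by \<open>m!\<close> and summing
  gives \<open>d exp K = exp K d + S exp K\<close>, that is \<open>exp K d = (d - S) exp K\<close>
  (\<open>exp_comb_intertwines\<close>). Since \<open>K\<close> lowers the second index it is nilpotent, so \<open>exp K\<close> is a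
  polynomial in \<open>K\<close>; hence it is bounded, and so is its inverse \<open>exp (-K)\<close>
  (\<open>exp_comb_inverse\<close>). That the twisted operator squares to zero follows as well: it is conjugate
  to \<open>d\<close>.

  An isomorphism of complexes maps kernels onto kernels and ranges onto ranges, so it induces an
  isomorphism of cohomology (\<open>cohomology_iso\<close>). For the untwisted complex, kernel and range
  are themselves direct sums over the rows, and the quotient of a direct sum by a direct sum of
  subspaces is the direct sum of the quotients (\<open>quotient_of_sum_iso\<close>).

  The algebra with \<open>K\<close> does not depend on the direct sum structure and is carried out for bounded
  operators between subspaces of an arbitrary vector space with a seminorm. It is then used with two
  such spaces: the ambient Hilbert space, and the sequences in it with the Hilbert norm of their
  components \<open>0, \<dots>, N\<close>.
\<close>

section \<open>Bounded operators between subspaces of a seminormed space\<close>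

text \<open>
  The norm is only required to be a seminorm because \<open>sum_norm N\<close> is applied to all functions on the
  integers and ignores the components outside \<open>0, \<dots>, N\<close>.
\<close>

locale seminormed_space = vector_space scl
  for scl :: "'k::real_normed_field \<Rightarrow> 'v::ab_group_add \<Rightarrow> 'v" +
  fixes nrm :: "'v \<Rightarrow> real"
  assumes nrm_triangle: "nrm (x + y) \<le> nrm x + nrm y"
    and nrm_scale: "nrm (scl c x) = norm c * nrm x"
    and nrm_nonneg: "0 \<le> nrm x"
begin

abbreviation bounded_op :: "'v set \<Rightarrow> 'v set \<Rightarrow> ('v \<Rightarrow> 'v) \<Rightarrow> bool" where
  "bounded_op \<equiv> bounded_linear_op scl nrm"

lemma bounded_opI:
  assumes "\<And>x. x \<in> X \<Longrightarrow> f x \<in> Y"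
    and "\<And>x y. x \<in> X \<Longrightarrow> y \<in> X \<Longrightarrow> f (x + y) = f x + f y"
    and "\<And>c x. x \<in> X \<Longrightarrow> f (scl c x) = scl c (f x)"
    and "\<And>x. x \<in> X \<Longrightarrow> nrm (f x) \<le> B * nrm x"
  shows "bounded_op X Y f"
  using assms unfolding bounded_linear_op_def by blast

lemma bounded_op_mem: "bounded_op X Y f \<Longrightarrow> x \<in> X \<Longrightarrow> f x \<in> Y"
  and bounded_op_add: "bounded_op X Y f \<Longrightarrow> x \<in> X \<Longrightarrow> y \<in> X \<Longrightarrow> f (x + y) = f x + f y"
  and bounded_op_scale: "bounded_op X Y f \<Longrightarrow> x \<in> X \<Longrightarrow> f (scl c x) = scl c (f x)"
  unfolding bounded_linear_op_def by blast+

lemma bounded_op_zero: "bounded_op X Y f \<Longrightarrow> subspace X \<Longrightarrow> f 0 = 0"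
  using bounded_op_add[of X Y f 0 0] subspace_0 by fastforce

lemma bounded_op_bound:
  assumes "bounded_op X Y f"
  obtains B where "0 \<le> B" "\<And>x. x \<in> X \<Longrightarrow> nrm (f x) \<le> B * nrm x"
proof -
  obtain B where B: "\<forall>x\<in>X. nrm (f x) \<le> B * nrm x"
    using assms unfolding bounded_linear_op_def by blast
  have "nrm (f x) \<le> \<bar>B\<bar> * nrm x" if "x \<in> X" for x
    using B that mult_right_mono[OF abs_ge_self[of B] nrm_nonneg[of x]] by fastforce
  then show thesis using that[of "\<bar>B\<bar>"] by simp
qed

lemma bounded_op_cong:
  assumes "bounded_op X Y f" "subspace X" "\<And>x. x \<in> X \<Longrightarrow> g x = f x"
  shows "bounded_op X Y g"
  using assms unfolding bounded_linear_op_def Pi_iff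
  by (simp add: subspace_add subspace_scale)

lemma bounded_op_id: "bounded_op X X (\<lambda>x. x)"
  by (rule bounded_opI[where B = 1]) auto

lemma bounded_op_comp:
  assumes f: "bounded_op X Y f" and g: "bounded_op Y W g"
  shows "bounded_op X W (\<lambda>x. g (f x))"
proof -
  obtain B where B: "\<And>x. x \<in> X \<Longrightarrow> nrm (f x) \<le> B * nrm x"
    using bounded_op_bound[OF f] by blast
  obtain C where C: "0 \<le> C" "\<And>y. y \<in> Y \<Longrightarrow> nrm (g y) \<le> C * nrm y"
    using bounded_op_bound[OF g] by blast
  show ?thesis
  proof (rule bounded_opI[where B = "C * B"])
    fix x assume x: "x \<in> X"
    have "nrm (g (f x)) \<le> C * nrm (f x)" using C(2) bounded_op_mem[OF f x] .
    also have "\<dots> \<le> C * (B * nrm x)" by (rule mult_left_mono[OF B[OF x] C(1)])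
    finally show "nrm (g (f x)) \<le> C * B * nrm x" by (simp add: mult.assoc)
  qed (simp_all add: bounded_op_mem[OF f] bounded_op_mem[OF g] bounded_op_add[OF f]
      bounded_op_add[OF g] bounded_op_scale[OF f] bounded_op_scale[OF g])
qed

text \<open>This is what makes polynomials in a bounded operator bounded.\<close>

lemma bounded_op_sum_scale:
  assumes f: "\<And>m. m \<in> A \<Longrightarrow> bounded_op X Y (f m)" and "finite A" "subspace Y"
  shows "bounded_op X Y (\<lambda>x. \<Sum>m\<in>A. scl (c m) (f m x))"
  using assms(2) f
proof (induction A)
  case empty
  show ?case using \<open>subspace Y\<close> by (intro bounded_opI[where B = 0])
    (auto simp: subspace_0 nrm_scale[of 0 0, simplified])
next
  case (insert a A)
  let ?g = "\<lambda>x. \<Sum>m\<in>A. scl (c m) (f m x)"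
  have g: "bounded_op X Y ?g" and fa: "bounded_op X Y (f a)" using insert by auto
  obtain B where B: "\<And>x. x \<in> X \<Longrightarrow> nrm (?g x) \<le> B * nrm x"
    using bounded_op_bound[OF g] by blast
  obtain C where C: "\<And>x. x \<in> X \<Longrightarrow> nrm (f a x) \<le> C * nrm x"
    using bounded_op_bound[OF fa] by blast
  have "bounded_op X Y (\<lambda>x. scl (c a) (f a x) + ?g x)"
  proof (rule bounded_opI[where B = "norm (c a) * C + B"])
    fix x assume x: "x \<in> X"
    have "nrm (scl (c a) (f a x) + ?g x) \<le> norm (c a) * nrm (f a x) + nrm (?g x)"
      using nrm_triangle nrm_scale by metis
    also have "\<dots> \<le> norm (c a) * (C * nrm x) + B * nrm x"
      by (intro add_mono mult_left_mono B C x norm_ge_zero)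
    finally show "nrm (scl (c a) (f a x) + ?g x) \<le> (norm (c a) * C + B) * nrm x"
      by (simp add: algebra_simps)
    show "scl (c a) (f a x) + ?g x \<in> Y"
      using x \<open>subspace Y\<close> bounded_op_mem[OF g] bounded_op_mem[OF fa]
      by (simp add: subspace_add subspace_scale)
  next
    fix x y assume x: "x \<in> X" "y \<in> X"
    show "scl (c a) (f a (x + y)) + ?g (x + y)
        = scl (c a) (f a x) + ?g x + (scl (c a) (f a y) + ?g y)"
      unfolding bounded_op_add[OF g x] bounded_op_add[OF fa x]
      by (simp add: scale_right_distrib)
  next
    fix r x assume x: "x \<in> X"
    show "scl (c a) (f a (scl r x)) + ?g (scl r x) = scl r (scl (c a) (f a x) + ?g x)"
      unfolding bounded_op_scale[OF g x] bounded_op_scale[OF fa x]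
      by (simp add: scale_right_distrib mult.commute)
  qed
  then show ?case using insert by simp
qed

lemma bounded_op_diff:
  assumes f: "bounded_op X Y f" and g: "bounded_op X Y g" and Y: "subspace Y"
  shows "bounded_op X Y (\<lambda>x. f x - g x)"
  using bounded_op_sum_scale[of "UNIV :: bool set" X Y "\<lambda>b. if b then f else g"
      "\<lambda>b. if b then 1 else - 1"] assms
  by (simp add: UNIV_bool)

lemma bounded_op_funpow: "bounded_op X X T \<Longrightarrow> bounded_op X X (T ^^ m)"
  by (induction m) (auto simp: bounded_op_id id_def comp_def dest: bounded_op_comp)

lemma bounded_op_sum:
  assumes f: "bounded_op X Y f" and X: "subspace X" and x: "\<And>i. i \<in> A \<Longrightarrow> x i \<in> X"
  shows "f (\<Sum>i\<in>A. scl (c i) (x i)) = (\<Sum>i\<in>A. scl (c i) (f (x i)))"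
proof (cases "finite A")
  case True
  then show ?thesis using x
  proof (induction A)
    case empty
    show ?case using bounded_op_zero[OF f X] by simp
  next
    case (insert a A)
    have "(\<Sum>i\<in>A. scl (c i) (x i)) \<in> X" "x a \<in> X" "scl (c a) (x a) \<in> X"
      using insert.prems X by (auto intro!: subspace_sum subspace_scale)
    then show ?case
      using insert by (simp add: bounded_op_add[OF f] bounded_op_scale[OF f])
  qed
qed (use bounded_op_zero[OF f X] in simp)


section \<open>Polynomials in a nilpotent operator and the exponential\<close>

text \<open>
  For a nilpotent \<open>T\<close>, a power series in \<open>T\<close> is such a truncated one, and \<open>M\<close> is a bound beyond
  which the powers of \<open>T\<close> vanish.
\<close>

definition power_comb :: "(nat \<Rightarrow> 'k) \<Rightarrow> nat \<Rightarrow> ('v \<Rightarrow> 'v) \<Rightarrow> 'v \<Rightarrow> 'v" where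
  "power_comb c M T x = (\<Sum>m\<le>M. scl (c m) ((T ^^ m) x))"

lemma bounded_op_power_comb:
  assumes "bounded_op X X T" "subspace X"
  shows "bounded_op X X (power_comb c M T)"
  unfolding power_comb_def
  by (intro bounded_op_sum_scale bounded_op_funpow assms) simp

text \<open>
  Nilpotent operators admit the Cauchy product of power series: the product of the truncations
  differs from the truncation of the product only by terms of total degree above \<open>M\<close>, which vanish.
\<close>

lemma power_comb_comp:
  assumes T: "bounded_op X X T" and X: "subspace X" and x: "x \<in> X"
    and nil: "\<And>m. M < m \<Longrightarrow> (T ^^ m) x = 0"
  shows "power_comb a M T (power_comb b M T x)
    = power_comb (\<lambda>k. \<Sum>i\<le>k. a i * b (k - i)) M T x"
proof -
  let ?t = "\<lambda>i l. scl (a i * b l) ((T ^^ (i + l)) x)"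
  have mem: "(T ^^ l) x \<in> X" for l
    using bounded_op_mem[OF bounded_op_funpow[OF T] x] .
  have "power_comb a M T (power_comb b M T x) = (\<Sum>i\<le>M. \<Sum>l\<le>M. ?t i l)"
    unfolding power_comb_def
    by (simp add: bounded_op_sum[OF bounded_op_funpow[OF T] X mem] scale_sum_right funpow_add)
  also have "\<dots> = (\<Sum>(i, l)\<in>{..M} \<times> {..M}. ?t i l)"
    by (simp add: sum.cartesian_product)
  also have "\<dots> = (\<Sum>(i, l)\<in>{(i, l). i + l \<le> M}. ?t i l)"
    using nil by (intro sum.mono_neutral_right) (auto, meson not_le)
  also have "\<dots> = (\<Sum>k\<le>M. \<Sum>i\<le>k. ?t i (k - i))"
    by (rule sum.triangle_reindex_eq)
  also have "\<dots> = power_comb (\<lambda>k. \<Sum>i\<le>k. a i * b (k - i)) M T x"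
    unfolding power_comb_def by (intro sum.cong refl) (simp add: scale_sum_left)
  finally show ?thesis .
qed

abbreviation exp_comb :: "nat \<Rightarrow> ('v \<Rightarrow> 'v) \<Rightarrow> 'v \<Rightarrow> 'v" where
  "exp_comb \<equiv> power_comb (\<lambda>m. 1 / fact m)"

abbreviation exp_neg_comb :: "nat \<Rightarrow> ('v \<Rightarrow> 'v) \<Rightarrow> 'v \<Rightarrow> 'v" where
  "exp_neg_comb \<equiv> power_comb (\<lambda>m. (- 1) ^ m / fact m)"

text \<open>
  The coefficients of \<open>exp (-t) exp t = 1\<close>: up to the factor \<open>1 / k!\<close>, the sum is the alternating sum
  of the binomial coefficients.
\<close>

lemma exp_coeff_convolution:
  "(\<Sum>i\<le>k. (- 1) ^ i / fact i * (1 / fact (k - i))) = (if k = 0 then 1 else 0 :: 'k)"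
proof (cases "k = 0")
  case False
  have "(\<Sum>i\<le>k. (- 1) ^ i / fact i * (1 / fact (k - i)) :: 'k)
      = (\<Sum>i\<le>k. (- 1) ^ i * of_nat (k choose i)) / fact k"
    unfolding sum_divide_distrib
    by (intro sum.cong refl) (simp add: binomial_fact)
  then show ?thesis using False choose_alternating_sum[of k, where 'a = 'k] by simp
qed simp

lemma power_comb_unit: "power_comb (\<lambda>k. if k = 0 then 1 else 0) M T x = x"
proof -
  have "power_comb (\<lambda>k. if k = 0 then 1 else 0) M T x = (\<Sum>m\<le>M. if m = 0 then x else 0)"
    unfolding power_comb_def by (intro sum.cong) auto
  then show ?thesis by simp
qed

lemma exp_comb_inverse:
  assumes "bounded_op X X T" "subspace X" "x \<in> X" "\<And>m. M < m \<Longrightarrow> (T ^^ m) x = 0"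
  shows "exp_neg_comb M T (exp_comb M T x) = x"
    and "exp_comb M T (exp_neg_comb M T x) = x"
proof -
  show "exp_neg_comb M T (exp_comb M T x) = x"
    by (simp only: power_comb_comp[OF assms] exp_coeff_convolution power_comb_unit)
  have flip: "(\<Sum>i\<le>k. 1 / fact i * ((- 1) ^ (k - i) / fact (k - i))) = (if k = 0 then 1 else 0 :: 'k)"
    for k
    unfolding exp_coeff_convolution[symmetric]
    by (rule sum.reindex_bij_witness[of _ "\<lambda>i. k - i" "\<lambda>i. k - i"]) auto
  show "exp_comb M T (exp_neg_comb M T x) = x"
    by (simp only: power_comb_comp[OF assms] flip power_comb_unit)
qed

text \<open>
  Each of the \<open>m + 1\<close> factors \<open>K\<close> that \<open>d\<close> passes leaves one commutator \<open>S\<close> behind, and these terms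
  agree because \<open>S\<close> commutes with the remaining factors. The operator on the target of \<open>d\<close> and \<open>S\<close>
  has its own name \<open>L\<close>, since in a complex \<open>K\<close> depends on the degree.
\<close>

lemma commutator_funpow:
  assumes X: "subspace X" and Y: "subspace Y"
    and K: "bounded_op X X K" and L: "bounded_op Y Y L"
    and S: "bounded_op X Y S" and d: "bounded_op X Y d"
    and SK: "\<And>x. x \<in> X \<Longrightarrow> S (K x) = L (S x)"
    and dK: "\<And>x. x \<in> X \<Longrightarrow> S x = d (K x) - L (d x)"
    and x: "x \<in> X"
  shows "d ((K ^^ Suc m) x) = (L ^^ Suc m) (d x) + scl (of_nat (Suc m)) (S ((K ^^ m) x))"
proof (induction m)
  case 0
  show ?case using dK[OF x] by simp
next
  case (Suc m)
  have mem: "(K ^^ l) x \<in> X" for l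
    using bounded_op_mem[OF bounded_op_funpow[OF K] x] .
  have Lmem: "(L ^^ l) (d x) \<in> Y" for l
    using bounded_op_mem[OF bounded_op_funpow[OF L]] bounded_op_mem[OF d x] by blast
  have s: "S ((K ^^ m) x) \<in> Y" using bounded_op_mem[OF S mem] .
  have "d ((K ^^ Suc (Suc m)) x) = L (d ((K ^^ Suc m) x)) + S ((K ^^ Suc m) x)"
    using dK[OF mem, of "Suc m"] by simp
  also have "L (d ((K ^^ Suc m) x))
      = L ((L ^^ Suc m) (d x)) + scl (of_nat (Suc m)) (L (S ((K ^^ m) x)))"
    unfolding Suc.IH bounded_op_add[OF L Lmem subspace_scale[OF Y s]] bounded_op_scale[OF L s] ..
  also have "L (S ((K ^^ m) x)) = S ((K ^^ Suc m) x)"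
    using SK[OF mem, of m] by simp
  finally show ?case
    by (simp only: of_nat_Suc[of "Suc m"] scale_left_distrib scale_one funpow.simps comp_apply add_ac)
qed

text \<open>
  In the commutator formula for \<open>m\<close> the factor \<open>m\<close> turns \<open>1 / m!\<close> into \<open>1 / (m - 1)!\<close>, so that the
  commutator terms again add up to the exponential series, shifted by one degree.
\<close>

lemma exp_comb_intertwines:
  assumes X: "subspace X" and Y: "subspace Y"
    and K: "bounded_op X X K" and L: "bounded_op Y Y L"
    and S: "bounded_op X Y S" and d: "bounded_op X Y d"
    and SK: "\<And>x. x \<in> X \<Longrightarrow> S (K x) = L (S x)"
    and dK: "\<And>x. x \<in> X \<Longrightarrow> S x = d (K x) - L (d x)"
    and nilK: "\<And>x. x \<in> X \<Longrightarrow> (K ^^ Suc M) x = 0"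
    and nilL: "\<And>y. y \<in> Y \<Longrightarrow> (L ^^ Suc M) y = 0"
    and x: "x \<in> X"
  shows "exp_comb M L (d x) = d (exp_comb M K x) - S (exp_comb M K x)"
proof -
  have mem: "(K ^^ l) x \<in> X" for l
    using bounded_op_mem[OF bounded_op_funpow[OF K] x] .
  \<comment> \<open>The index shift loses the top degree. Starting one degree higher, where the powers vanish
    already, leaves exactly the truncation at \<open>M\<close> in the commutator terms.\<close>
  have extend: "power_comb c (Suc M) K x = power_comb c M K x"
    "power_comb c (Suc M) L (d x) = power_comb c M L (d x)" for c
    unfolding power_comb_def using nilK[OF x] nilL[OF bounded_op_mem[OF d x]]
    by (simp_all del: funpow.simps)
  have "d (exp_comb (Suc M) K x) = (\<Sum>m\<le>Suc M. scl (1 / fact m) (d ((K ^^ m) x)))"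
    unfolding power_comb_def by (rule bounded_op_sum[OF d X mem])
  also have "\<dots> = d x + (\<Sum>m\<le>M. scl (1 / fact (Suc m)) (d ((K ^^ Suc m) x)))"
    by (subst sum.atMost_Suc_shift) simp
  also have "\<dots> = d x + (\<Sum>m\<le>M. scl (1 / fact (Suc m)) ((L ^^ Suc m) (d x)))
      + (\<Sum>m\<le>M. scl (1 / fact m) (S ((K ^^ m) x)))"
  proof -
    have "scl (1 / fact (Suc m)) (scl (of_nat (Suc m)) y) = scl (1 / fact m) y" for m y
      by (simp add: field_simps del: of_nat_Suc)
    moreover have "d ((K ^^ Suc m) x) = (L ^^ Suc m) (d x) + scl (of_nat (Suc m)) (S ((K ^^ m) x))"
      for m using SK dK x by (intro commutator_funpow[OF X Y K L S d])
    ultimately show ?thesis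
      by (simp only: scale_right_distrib sum.distrib add.assoc)
  qed
  also have "d x + (\<Sum>m\<le>M. scl (1 / fact (Suc m)) ((L ^^ Suc m) (d x)))
      = exp_comb (Suc M) L (d x)"
    unfolding power_comb_def sum.atMost_Suc_shift
    by (simp del: fact_Suc funpow.simps(2))
  also have "(\<Sum>m\<le>M. scl (1 / fact m) (S ((K ^^ m) x))) = S (exp_comb M K x)"
    unfolding power_comb_def by (rule bounded_op_sum[OF S X mem, symmetric])
  finally show ?thesis unfolding extend by simp
qed


section \<open>Cohomology under isomorphisms of complexes\<close>

text \<open>The isomorphism sends a coset to its image under \<open>g\<close>, which is a coset of \<open>g ` U\<close>.\<close>

lemma quotient_vspace_iso:
  assumes X: "subspace X" and U: "U \<subseteq> X"
    and add: "\<And>x y. x \<in> X \<Longrightarrow> y \<in> X \<Longrightarrow> g (x + y) = g x + g y"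
    and scale: "\<And>c x. x \<in> X \<Longrightarrow> g (scl c x) = scl c (g x)"
    and inj: "inj_on g X" and onto: "g ` X = X'" "g ` U = U'"
  shows "vs_isomorphic (quotient_vspace scl X U) (quotient_vspace scl X' U')"
proof -
  let ?Q = "{{x + u | u. u \<in> U} | x. x \<in> X}"
  have sub: "A \<subseteq> X" if "A \<in> ?Q" for A
    using that U X by (auto intro!: subspace_add)
  have coset: "g ` {x + u | u. u \<in> U} = {g x + u | u. u \<in> U'}" if "x \<in> X" for x
  proof -
    have "g ` {x + u | u. u \<in> U} = (\<lambda>u. g (x + u)) ` U" by blast
    also have "\<dots> = (\<lambda>u. g x + g u) ` U" using add that U by (intro image_cong) auto
    also have "\<dots> = {g x + u | u. u \<in> U'}" using onto(2) by blast
    finally show ?thesis .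
  qed
  have image: "(`) g ` ?Q = {{x + u | u. u \<in> U'} | x. x \<in> X'}"
  proof -
    have "?Q = (\<lambda>x. {x + u | u. u \<in> U}) ` X" by blast
    then have "(`) g ` ?Q = (\<lambda>x. g ` {x + u | u. u \<in> U}) ` X" by (simp add: image_image)
    also have "\<dots> = (\<lambda>x. {g x + u | u. u \<in> U'}) ` X" using coset by (intro image_cong) auto
    also have "\<dots> = {{x + u | u. u \<in> U'} | x. x \<in> X'}" using onto(1) by blast
    finally show ?thesis .
  qed
  show ?thesis
    unfolding vs_isomorphic_def quotient_vspace_def vspace.simps
  proof (intro exI[of _ "(`) g"] conjI ballI allI)
    show "bij_betw ((`) g) ?Q {{x + u | u. u \<in> U'} | x. x \<in> X'}"
      unfolding bij_betw_def image
    proof (intro conjI refl inj_onI)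
      fix A B assume "A \<in> ?Q" "B \<in> ?Q" "g ` A = g ` B"
      then show "A = B" using inj_on_image_eq_iff[OF inj sub sub] by blast
    qed
  next
    fix A B assume "A \<in> ?Q" "B \<in> ?Q"
    then have "A \<subseteq> X" "B \<subseteq> X" using sub by blast+
    then have eq: "g (a + b) = g a + g b" if "a \<in> A" "b \<in> B" for a b using add that by blast
    show "g ` {a + b | a b. a \<in> A \<and> b \<in> B} = {a + b | a b. a \<in> g ` A \<and> b \<in> g ` B}"
      (is "?l = ?r")
    proof
      show "?l \<subseteq> ?r" using eq by blast
      show "?r \<subseteq> ?l" using eq[symmetric] by blast
    qed
  next
    fix c A assume "A \<in> ?Q"
    then have A: "A \<subseteq> X" using sub by blast
    have eq: "g (scl c a + u) = scl c (g a) + g u" if "a \<in> A" "u \<in> U" for a u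
    proof -
      have "a \<in> X" "u \<in> X" using that A U by blast+
      then show ?thesis using add[OF subspace_scale[OF X]] scale by simp
    qed
    show "g ` {scl c a + u | a u. a \<in> A \<and> u \<in> U} = {scl c a + u | a u. a \<in> g ` A \<and> u \<in> U'}"
      (is "?l = ?r")
    proof
      show "?l \<subseteq> ?r" using eq onto(2) by blast
      show "?r \<subseteq> ?l" unfolding onto(2)[symmetric] using eq[symmetric] by blast
    qed
  qed
qed

text \<open>
  The inverse of \<open>F\<close> is again a chain map, so it carries kernel and range of \<open>D'\<close> onto those of \<open>D\<close>.
\<close>

lemma cohomology_iso:
  assumes D: "bounded_complex scl nrm X D" and D': "bounded_complex scl nrm X D'"
    and X: "\<And>i. subspace (X i)"
    and F: "bounded_complex_iso scl nrm X D D' F"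
  shows "vs_isomorphic (cohomology scl X D' k) (cohomology scl X D k)"
proof -
  have Dop: "bounded_op (X i) (X (i + 1)) (D i)" and D'op: "bounded_op (X i) (X (i + 1)) (D' i)"
    and D'D': "x \<in> X i \<Longrightarrow> D' (i + 1) (D' i x) = 0" for i x
    using D D' unfolding bounded_complex_def by blast+
  have Fop: "bounded_op (X i) (X i) (F i)" and Fbij: "bij_betw (F i) (X i) (X i)"
    and FDall: "\<forall>x\<in>X i. F (i + 1) (D i x) = D' i (F i x)"
    and Gop': "bounded_op (X i) (X i) (inv_into (X i) (F i))" for i
    using F unfolding bounded_complex_iso_def by blast+
  have FD: "F (i + 1) (D i x) = D' i (F i x)" if "x \<in> X i" for i x
    using FDall that by blast
  define G where "G i = inv_into (X i) (F i)" for i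
  have Gop: "bounded_op (X i) (X i) (G i)" for i using Gop' unfolding G_def .
  have FG: "F i (G i y) = y" if "y \<in> X i" for i y
    unfolding G_def using Fbij that by (auto simp: bij_betw_def intro: f_inv_into_f)
  have GF: "G i (F i x) = x" if "x \<in> X i" for i x
    unfolding G_def using Fbij that by (auto simp: bij_betw_def)
  have GD: "D i (G i y) = G (i + 1) (D' i y)" if y: "y \<in> X i" for i y
    using GF[OF bounded_op_mem[OF Dop bounded_op_mem[OF Gop y]]]
    by (simp add: FD[OF bounded_op_mem[OF Gop y]] FG[OF y])
  have prev: "k - 1 + 1 = k" by simp
  note D'prev = D'op[of "k - 1", unfolded prev] and GDprev = GD[of _ "k - 1", unfolded prev]
  show ?thesis unfolding cohomology_def
  proof (rule quotient_vspace_iso[where g = "G k"])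
    show "subspace {x \<in> X k. D' k x = 0}"
      using X[of k] bounded_op_zero[OF D'op X] unfolding subspace_def
      by (auto simp: bounded_op_add[OF D'op] bounded_op_scale[OF D'op])
    show "D' (k - 1) ` X (k - 1) \<subseteq> {x \<in> X k. D' k x = 0}"
      using bounded_op_mem[OF D'prev] D'D'[of _ "k - 1", unfolded prev] by auto
    show "inj_on (G k) {x \<in> X k. D' k x = 0}"
      by (rule inj_on_inverseI[where g = "F k"]) (simp add: FG)
    show "G k ` {x \<in> X k. D' k x = 0} = {x \<in> X k. D k x = 0}"
    proof (intro equalityI subsetI)
      fix x assume "x \<in> G k ` {x \<in> X k. D' k x = 0}"
      then show "x \<in> {x \<in> X k. D k x = 0}"
        using GD bounded_op_mem[OF Gop] bounded_op_zero[OF Gop X] by auto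
    next
      fix x assume x: "x \<in> {x \<in> X k. D k x = 0}"
      then have "D' k (F k x) = 0" using FD[of x k] bounded_op_zero[OF Fop X] by simp
      then show "x \<in> G k ` {x \<in> X k. D' k x = 0}"
        using x bounded_op_mem[OF Fop] by (intro image_eqI[where x = "F k x"]) (auto simp: GF)
    qed
    show "G k ` D' (k - 1) ` X (k - 1) = D (k - 1) ` X (k - 1)"
    proof -
      have "G k ` D' (k - 1) ` X (k - 1) = (\<lambda>y. D (k - 1) (G (k - 1) y)) ` X (k - 1)"
        unfolding image_image by (intro image_cong) (auto simp: GDprev)
      also have "\<dots> = D (k - 1) ` G (k - 1) ` X (k - 1)" by (simp add: image_image)
      also have "G (k - 1) ` X (k - 1) = X (k - 1)"
        using bounded_op_mem[OF Gop] bounded_op_mem[OF Fop] GF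
        by (auto simp: set_eq_iff image_iff) metis
      finally show ?thesis .
    qed
  qed (use bounded_op_add[OF Gop] bounded_op_scale[OF Gop] in auto)
qed

end

lemma vs_isomorphic_trans:
  assumes "vs_isomorphic V W" "vs_isomorphic W R"
  shows "vs_isomorphic V R"
proof -
  obtain f where f: "bij_betw f (vs_carrier V) (vs_carrier W)"
    "\<forall>x\<in>vs_carrier V. \<forall>y\<in>vs_carrier V. f (vs_add V x y) = vs_add W (f x) (f y)"
    "\<forall>c. \<forall>x\<in>vs_carrier V. f (vs_scale V c x) = vs_scale W c (f x)"
    using assms(1) unfolding vs_isomorphic_def by blast
  obtain g where g: "bij_betw g (vs_carrier W) (vs_carrier R)"
    "\<forall>x\<in>vs_carrier W. \<forall>y\<in>vs_carrier W. g (vs_add W x y) = vs_add R (g x) (g y)"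
    "\<forall>c. \<forall>x\<in>vs_carrier W. g (vs_scale W c x) = vs_scale R c (g x)"
    using assms(2) unfolding vs_isomorphic_def by blast
  have "f x \<in> vs_carrier W" if "x \<in> vs_carrier V" for x
    using f(1) that bij_betwE by blast
  then show ?thesis
    unfolding vs_isomorphic_def using bij_betw_trans[OF f(1) g(1)] f(2,3) g(2,3)
    by (intro exI[of _ "g \<circ> f"]) auto
qed

section \<open>Finite direct sums of Hilbert spaces\<close>

lemma hilbert_scale_seminormed_space: "hilbert_scale scl \<Longrightarrow> seminormed_space scl norm"
  unfolding hilbert_scale_def seminormed_space_def seminormed_space_axioms_def
  by (auto intro: norm_triangle_ineq)

lemma direct_sum_seminormed_space:
  assumes "hilbert_scale scl"
  shows "seminormed_space (sum_scale scl) (sum_norm N)"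
proof -
  interpret seminormed_space scl norm
    using hilbert_scale_seminormed_space[OF assms] .
  show ?thesis
  proof
    fix x y :: "int \<Rightarrow> 'b" and c
    show "sum_norm N (sum_scale scl c x) = norm c * sum_norm N x"
      unfolding sum_norm_def sum_scale_def nrm_scale
      by (simp add: L2_set_right_distrib)
    have "sum_norm N (x + y) \<le> L2_set (\<lambda>j. norm (x j) + norm (y j)) {0..int N}"
      unfolding sum_norm_def by (intro L2_set_mono) (auto intro: norm_triangle_ineq)
    also have "\<dots> \<le> sum_norm N x + sum_norm N y"
      unfolding sum_norm_def by (rule L2_set_triangle_ineq)
    finally show "sum_norm N (x + y) \<le> sum_norm N x + sum_norm N y" .
    show "0 \<le> sum_norm N x" unfolding sum_norm_def by (rule L2_set_nonneg)
  qed (auto simp: sum_scale_def scale_right_distrib scale_left_distrib fun_eq_iff)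
qed

lemma norm_le_sum_norm: "j \<in> {0..int N} \<Longrightarrow> norm (\<phi> j) \<le> sum_norm N \<phi>"
  unfolding sum_norm_def using member_le_L2_set[of "{0..int N}" j "\<lambda>j. norm (\<phi> j)"] by simp

lemma sum_space_memI:
  "(\<And>j. j \<in> {0..int N} \<Longrightarrow> \<phi> j \<in> Z i j) \<Longrightarrow> (\<And>j. j \<notin> {0..int N} \<Longrightarrow> \<phi> j = 0)
    \<Longrightarrow> \<phi> \<in> sum_space N Z i"
  unfolding sum_space_def by blast

lemma sum_space_subspace:
  assumes "hilbert_scale scl" "\<And>j. module.subspace scl (Z i j)"
  shows "module.subspace (sum_scale scl) (sum_space N Z i)"
proof -
  interpret Z: seminormed_space scl norm
    using hilbert_scale_seminormed_space[OF assms(1)] .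
  interpret seminormed_space "sum_scale scl" "sum_norm N"
    using direct_sum_seminormed_space[OF assms(1)] .
  show ?thesis
    unfolding subspace_def sum_space_def sum_scale_def using assms(2)
    by (auto intro: Z.subspace_0 Z.subspace_add Z.subspace_scale)
qed

text \<open>
  The Hilbert norm of a finite sum is at most the sum of the norms of the components, so the bounds
  of the components may simply be added.
\<close>

lemma sum_norm_bounded_componentwise:
  assumes "\<And>j. j \<in> {0..int N} \<Longrightarrow> \<exists>B. \<forall>\<phi>\<in>X. norm (T \<phi> j) \<le> B * sum_norm N \<phi>"
  shows "\<exists>B. \<forall>\<phi>\<in>X. sum_norm N (T \<phi>) \<le> B * sum_norm N \<phi>"
proof -
  obtain B where B: "\<And>j \<phi>. j \<in> {0..int N} \<Longrightarrow> \<phi> \<in> X \<Longrightarrow> norm (T \<phi> j) \<le> B j * sum_norm N \<phi>"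
    using assms by metis
  have "sum_norm N (T \<phi>) \<le> (\<Sum>j\<in>{0..int N}. B j) * sum_norm N \<phi>" if "\<phi> \<in> X" for \<phi>
  proof -
    have "sum_norm N (T \<phi>) \<le> (\<Sum>j\<in>{0..int N}. norm (T \<phi> j))"
      unfolding sum_norm_def by (intro L2_set_le_sum) simp
    also have "\<dots> \<le> (\<Sum>j\<in>{0..int N}. B j * sum_norm N \<phi>)"
      using B that by (intro sum_mono) blast
    finally show ?thesis by (simp add: sum_distrib_right)
  qed
  then show ?thesis by blast
qed

lemma sum_space_mem:
  assumes "\<phi> \<in> sum_space N Z i" "\<And>j. j \<notin> {0..int N} \<Longrightarrow> Z i j = {0}"
  shows "\<phi> j \<in> Z i j"
  using assms unfolding sum_space_def by (cases "j \<in> {0..int N}") auto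

text \<open>
  This covers \<open>diag_op\<close> with \<open>s = 0\<close> and \<open>shift_op\<close> with \<open>s = 1\<close>. Having zero spaces outside
  the range is what keeps the result in the sum space at the boundary.
\<close>

lemma reindexed_op_bounded:
  assumes scl: "hilbert_scale scl"
    and X: "\<And>j. module.subspace scl (Z i j)"
    and Zout: "\<And>i j. j \<notin> {0..int N} \<Longrightarrow> Z i j = {0}"
    and T: "\<And>j. bounded_linear_op scl norm (Z i (j + s)) (Z i' j) (T j)"
  shows "bounded_linear_op (sum_scale scl) (sum_norm N) (sum_space N Z i) (sum_space N Z i')
    (\<lambda>\<phi> j. T j (\<phi> (j + s)))"
proof -
  interpret Z: seminormed_space scl norm
    using hilbert_scale_seminormed_space[OF scl] .
  have mem: "\<phi> j \<in> Z i j" if "\<phi> \<in> sum_space N Z i" for \<phi> j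
    using that Zout by (rule sum_space_mem)
  have bound: "\<exists>B. \<forall>\<phi>\<in>sum_space N Z i. norm (T j (\<phi> (j + s))) \<le> B * sum_norm N \<phi>" for j
  proof -
    obtain B where B: "0 \<le> B" "\<And>x. x \<in> Z i (j + s) \<Longrightarrow> norm (T j x) \<le> B * norm x"
      using Z.bounded_op_bound[OF T] by blast
    have "norm (T j (\<phi> (j + s))) \<le> B * sum_norm N \<phi>" if \<phi>: "\<phi> \<in> sum_space N Z i" for \<phi>
    proof -
      have "norm (\<phi> (j + s)) \<le> sum_norm N \<phi>"
      proof (cases "j + s \<in> {0..int N}")
        case False
        then have "\<phi> (j + s) = 0" using \<phi> unfolding sum_space_def by blast
        then show ?thesis by (simp add: sum_norm_def L2_set_nonneg)
      qed (rule norm_le_sum_norm)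
      then show ?thesis
        using B(2)[OF mem[OF \<phi>]] mult_left_mono[OF _ B(1)] by (meson order_trans)
    qed
    then show ?thesis by blast
  qed
  show ?thesis
    unfolding bounded_linear_op_def
  proof (intro conjI ballI allI funcsetI)
    fix \<phi> assume \<phi>: "\<phi> \<in> sum_space N Z i"
    have "T j (\<phi> (j + s)) \<in> Z i' j" for j
      using Z.bounded_op_mem[OF T mem[OF \<phi>]] .
    then show "(\<lambda>j. T j (\<phi> (j + s))) \<in> sum_space N Z i'"
      using Zout by (intro sum_space_memI) auto
    show "(\<lambda>j. T j (sum_scale scl c \<phi> (j + s))) = sum_scale scl c (\<lambda>j. T j (\<phi> (j + s)))" for c
      unfolding sum_scale_def using Z.bounded_op_scale[OF T mem[OF \<phi>]] by auto
    fix \<psi> assume \<psi>: "\<psi> \<in> sum_space N Z i"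
    show "(\<lambda>j. T j ((\<phi> + \<psi>) (j + s))) = (\<lambda>j. T j (\<phi> (j + s))) + (\<lambda>j. T j (\<psi> (j + s)))"
      using Z.bounded_op_add[OF T mem[OF \<phi>] mem[OF \<psi>]] by (simp add: fun_eq_iff)
  next
    show "\<exists>B. \<forall>\<phi>\<in>sum_space N Z i.
        sum_norm N (\<lambda>j. T j (\<phi> (j + s))) \<le> B * sum_norm N \<phi>"
      by (rule sum_norm_bounded_componentwise) (rule bound)
  qed
qed

section \<open>The quotient of a direct sum\<close>

text \<open>A coset of a direct sum is determined by its components, which are cosets of the summands.\<close>

lemma sum_coset_componentwise:
  fixes x :: "int \<Rightarrow> 'a::ab_group_add"
  assumes x: "\<And>j. j \<notin> {0..int N} \<Longrightarrow> x j = 0"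
  shows "{x + u | u. u \<in> sum_space N U i} = sum_space N (\<lambda>i j. {x j + u | u. u \<in> U i j}) i"
proof (intro equalityI subsetI)
  fix \<phi> assume \<phi>: "\<phi> \<in> sum_space N (\<lambda>i j. {x j + u | u. u \<in> U i j}) i"
  have "\<phi> - x \<in> sum_space N U i"
    using \<phi> x unfolding sum_space_def by force
  moreover have "\<phi> = x + (\<phi> - x)" by (simp add: fun_eq_iff)
  ultimately show "\<phi> \<in> {x + u | u. u \<in> sum_space N U i}" by blast
qed (use x in \<open>auto simp: sum_space_def\<close>)

text \<open>
  An element of one component extends to all of them only if no other component is empty.
\<close>

lemma sum_space_component:
  assumes "\<And>j. j \<in> {0..int N} \<Longrightarrow> Z i j \<noteq> {}" and j: "j \<in> {0..int N}"
  shows "(\<lambda>\<phi>. \<phi> j) ` sum_space N Z i = Z i j"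
proof (intro equalityI subsetI)
  fix z assume z: "z \<in> Z i j"
  obtain w where w: "\<And>j. j \<in> {0..int N} \<Longrightarrow> w j \<in> Z i j"
    using that[of "\<lambda>j. SOME z. z \<in> Z i j"] assms(1) by (simp add: some_in_eq)
  have "(\<lambda>l. if l = j then z else if l \<in> {0..int N} then w l else 0) \<in> sum_space N Z i"
    using z w j by (intro sum_space_memI) auto
  then show "z \<in> (\<lambda>\<phi>. \<phi> j) ` sum_space N Z i" by (rule rev_image_eqI) simp
qed (use j in \<open>auto simp: sum_space_def\<close>)

text \<open>
  The isomorphism sends a coset to the family of its projections to the components. It is injective
  because a coset is the full product of its projections, not just a subset of it.
\<close>

lemma quotient_of_sum_iso:
  fixes scl :: "'k \<Rightarrow> 'a::ab_group_add \<Rightarrow> 'a"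
  assumes U: "\<And>j. j \<in> {0..int N} \<Longrightarrow> 0 \<in> U i j"
  shows "vs_isomorphic
    (quotient_vspace (sum_scale scl) (sum_space N X i) (sum_space N U i))
    (direct_sum_vspace {0..int N} (\<lambda>j. quotient_vspace scl (X i j) (U i j)))"
proof -
  let ?J = "{0..int N}"
  let ?pr = "\<lambda>A j. (\<lambda>\<phi>. \<phi> j) ` A"
  let ?f = "\<lambda>A. \<lambda>j\<in>?J. ?pr A j"
  let ?coset = "\<lambda>x j. {x j + u | u. u \<in> U i j}"
  let ?Q = "{{x + u | u. u \<in> sum_space N U i} | x. x \<in> sum_space N X i}"
  let ?P = "\<Pi>\<^sub>E j\<in>?J. {{x + u | u. u \<in> U i j} | x. x \<in> X i j}"
  have box: "{x + u | u. u \<in> sum_space N U i} = sum_space N (\<lambda>i. ?coset x) i"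
    if "x \<in> sum_space N X i" for x
    using sum_coset_componentwise[of N x U i] that unfolding sum_space_def by blast
  have pr: "?pr {x + u | u. u \<in> sum_space N U i} j = ?coset x j"
    if "x \<in> sum_space N X i" "j \<in> ?J" for x j
    unfolding box[OF that(1)] using U that(2) by (subst sum_space_component) auto
  have recover: "sum_space N (\<lambda>i. ?pr A) i = A" if Q: "A \<in> ?Q" for A
  proof -
    obtain x where x: "x \<in> sum_space N X i" and A: "A = {x + u | u. u \<in> sum_space N U i}"
      using Q by blast
    show ?thesis
      unfolding A box[OF x, symmetric] sum_space_def[of N "\<lambda>i. ?pr _"]
      using pr[OF x] box[OF x] unfolding sum_space_def[of N "\<lambda>i. ?coset x"] by auto
  qed
  have prU: "?pr (sum_space N U i) j = U i j" if "j \<in> ?J" for j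
    using U that by (intro sum_space_component) auto
  show ?thesis
    unfolding vs_isomorphic_def quotient_vspace_def direct_sum_vspace_def vspace.simps
  proof (intro exI[of _ ?f] conjI ballI allI)
    have "inj_on ?f ?Q"
    proof (rule inj_onI)
      fix A B assume A: "A \<in> ?Q" and B: "B \<in> ?Q" and "?f A = ?f B"
      then have "?pr A j = ?pr B j" if "j \<in> ?J" for j
        using that by (metis (no_types, lifting) restrict_apply')
      then have "sum_space N (\<lambda>i. ?pr A) i = sum_space N (\<lambda>i. ?pr B) i"
        unfolding sum_space_def by simp
      then show "A = B" unfolding recover[OF A] recover[OF B] .
    qed
    moreover have "?f ` ?Q = ?P"
    proof (intro equalityI subsetI)
      fix g assume "g \<in> ?f ` ?Q"
      then obtain x where x: "x \<in> sum_space N X i"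
        and g: "g = ?f {x + u | u. u \<in> sum_space N U i}" by blast
      have "g j \<in> {{x + u | u. u \<in> U i j} | x. x \<in> X i j}" if "j \<in> ?J" for j
        using pr[OF x that] that x unfolding g sum_space_def by auto
      then show "g \<in> ?P" unfolding g by auto
    next
      fix g assume g: "g \<in> ?P"
      then have "\<forall>j\<in>?J. \<exists>x. g j = {x + u | u. u \<in> U i j} \<and> x \<in> X i j" by (simp add: PiE_iff)
      from bchoice[OF this]
      obtain y where y: "\<And>j. j \<in> ?J \<Longrightarrow> g j = {y j + u | u. u \<in> U i j} \<and> y j \<in> X i j"
        by blast
      define x where "x j = (if j \<in> ?J then y j else 0)" for j
      have x: "x \<in> sum_space N X i"
        using y by (intro sum_space_memI) (auto simp: x_def)
      have "g = ?f {x + u | u. u \<in> sum_space N U i}"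
      proof
        fix j
        show "g j = ?f {x + u | u. u \<in> sum_space N U i} j"
          using pr[OF x, of j] y[of j] g by (cases "j \<in> ?J") (auto simp: x_def)
      qed
      then show "g \<in> ?f ` ?Q" using x by blast
    qed
    ultimately show "bij_betw ?f ?Q ?P" unfolding bij_betw_def by blast
  next
    fix A B :: "(int \<Rightarrow> 'a) set"
    have "?pr {a + b | a b. a \<in> A \<and> b \<in> B} j = {a + b | a b. a \<in> ?pr A j \<and> b \<in> ?pr B j}" for j
    proof (intro equalityI subsetI)
      fix z assume "z \<in> {a + b | a b. a \<in> ?pr A j \<and> b \<in> ?pr B j}"
      then obtain a b where "a \<in> A" "b \<in> B" "z = (a + b) j" by auto
      then show "z \<in> ?pr {a + b | a b. a \<in> A \<and> b \<in> B} j" by blast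
    qed (auto, blast)
    then show "?f {a + b | a b. a \<in> A \<and> b \<in> B}
        = (\<lambda>j\<in>?J. {a + b | a b. a \<in> ?f A j \<and> b \<in> ?f B j})"
      by (auto simp: fun_eq_iff)
  next
    fix c and A :: "(int \<Rightarrow> 'a) set"
    have "?pr {sum_scale scl c a + u | a u. a \<in> A \<and> u \<in> V} j
        = {scl c a + u | a u. a \<in> ?pr A j \<and> u \<in> ?pr V j}"
      for V :: "(int \<Rightarrow> 'a) set" and j
    proof (intro equalityI subsetI)
      fix z assume "z \<in> {scl c a + u | a u. a \<in> ?pr A j \<and> u \<in> ?pr V j}"
      then obtain a u where "a \<in> A" "u \<in> V" "z = (sum_scale scl c a + u) j"
        by (auto simp: sum_scale_def)
      then show "z \<in> ?pr {sum_scale scl c a + u | a u. a \<in> A \<and> u \<in> V} j" by blast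
    qed (auto simp: sum_scale_def, blast)
    then show "?f {sum_scale scl c a + u | a u. a \<in> A \<and> u \<in> sum_space N U i}
        = (\<lambda>j\<in>?J. {scl c a + u | a u. a \<in> ?f A j \<and> u \<in> U i j})"
      using prU by (auto simp: fun_eq_iff)
  qed
qed

section \<open>The exponential of the shift and the twisted complex\<close>

text \<open>
  The exponential is defined with real scalars and a componentwise series; on a nilpotent operator
  it is the finite sum over the scalars of the Hilbert space.
\<close>

lemma exp_op_eq_exp_comb:
  assumes scl: "hilbert_scale scl" and nil: "\<And>m. N < m \<Longrightarrow> (T ^^ m) \<phi> = 0"
  shows "exp_op T \<phi> = (\<Sum>m\<le>N. sum_scale scl (1 / fact m) ((T ^^ m) \<phi>))"
proof
  fix j
  have real_scale: "scl (1 / fact m) x = (1 / fact m) *\<^sub>R x" for m x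
  proof -
    have "scl (of_real (1 / fact m)) x = (1 / fact m) *\<^sub>R x"
      using scl unfolding hilbert_scale_def by blast
    then show ?thesis by simp
  qed
  have sum_apply: "(\<Sum>m\<in>A. h m) j = (\<Sum>m\<in>A. h m j)" for A and h :: "nat \<Rightarrow> int \<Rightarrow> 'b"
    by (induction A rule: infinite_finite_induct) auto
  have "exp_op T \<phi> j = (\<Sum>m\<le>N. (1 / fact m) *\<^sub>R (T ^^ m) \<phi> j)"
    unfolding exp_op_def by (intro suminf_finite) (auto simp: nil)
  then show "exp_op T \<phi> j = (\<Sum>m\<le>N. sum_scale scl (1 / fact m) ((T ^^ m) \<phi>)) j"
    by (simp add: sum_apply sum_scale_def real_scale)
qed

text \<open>
  The component \<open>j\<close> of the \<open>m\<close>-th power only sees the component \<open>j + m\<close> of the argument, which is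
  zero as soon as \<open>j + m > N\<close>.
\<close>

lemma shift_op_nilpotent:
  assumes shift: "\<And>\<phi>. \<phi> \<in> sum_space N Z i \<Longrightarrow> shift_op K i \<phi> \<in> sum_space N Z i"
    and K0: "\<And>j. K i j 0 = 0" and \<phi>: "\<phi> \<in> sum_space N Z i" and "N < m"
  shows "(shift_op K i ^^ m) \<phi> = 0"
proof
  fix j
  have top: "(shift_op K i ^^ l) \<phi> j = 0" if "int N < j + int l" for l j
    using that
  proof (induction l arbitrary: j)
    case 0
    then show ?case using \<phi> unfolding sum_space_def by auto
  next
    case (Suc l)
    then show ?case using Suc.IH[of "j + 1"] K0 by (simp add: shift_op_def)
  qed
  have mem: "(shift_op K i ^^ l) \<phi> \<in> sum_space N Z i" for l
    by (induction l) (auto simp: \<phi> shift)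
  show "(shift_op K i ^^ m) \<phi> j = 0 j"
  proof (cases "0 \<le> j")
    case True
    then show ?thesis using top[of j m] \<open>N < m\<close> by simp
  next
    case False
    then show ?thesis using mem[of m] unfolding sum_space_def by auto
  qed
qed

theorem theorem1:
  fixes n N :: nat
    and scl :: "'k::real_normed_field \<Rightarrow> 'a::{real_inner,complete_space} \<Rightarrow> 'a"
    and Z :: "int \<Rightarrow> int \<Rightarrow> 'a set"
    and d K S :: "int \<Rightarrow> int \<Rightarrow> 'a \<Rightarrow> 'a"
  assumes "hilbert_scale scl"
    and "\<And>i j. hilbert_subspace scl (Z i j)"
    and "\<And>i j. \<not> (0 \<le> i \<and> i \<le> int n \<and> 0 \<le> j \<and> j \<le> int N) \<Longrightarrow> Z i j = {0}"
    and "\<And>j. bounded_complex scl norm (\<lambda>i. Z i j) (\<lambda>i. d i j)"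
    and "\<And>i j. bounded_linear_op scl norm (Z i j) (Z i (j - 1)) (K i j)"
    and "\<And>i j. bounded_linear_op scl norm (Z i j) (Z (i + 1) (j - 1)) (S i j)"
    and "\<And>i j x. x \<in> Z i j \<Longrightarrow> S i (j - 1) (K i j x) = K (i + 1) (j - 1) (S i j x)"
    and "\<And>i j x. x \<in> Z i j \<Longrightarrow> S i j x = d i (j - 1) (K i j x) - K (i + 1) j (d i j x)"
  shows "bounded_complex (sum_scale scl) (sum_norm N) (sum_space N Z) (diag_op d) \<and>
     bounded_complex (sum_scale scl) (sum_norm N) (sum_space N Z) (twisted_op d S) \<and>
     bounded_complex_iso (sum_scale scl) (sum_norm N) (sum_space N Z)
       (diag_op d) (twisted_op d S) (\<lambda>i. exp_op (shift_op K i)) \<and>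
     (\<forall>k. vs_isomorphic
       (cohomology (sum_scale scl) (sum_space N Z) (twisted_op d S) k)
       (direct_sum_vspace {0..int N} (\<lambda>j. cohomology scl (\<lambda>i. Z i j) (\<lambda>i. d i j) k)))"
proof -
  interpret Z: seminormed_space scl norm
    using hilbert_scale_seminormed_space[OF assms(1)] .
  interpret seminormed_space "sum_scale scl" "sum_norm N"
    using direct_sum_seminormed_space[OF assms(1)] .
  let ?X = "sum_space N Z"
  let ?D = "diag_op d" and ?DV = "twisted_op d S"
  let ?K = "shift_op K" and ?S = "shift_op S"
  have Zsub: "Z.subspace (Z i j)" for i j
    using assms(2) unfolding hilbert_subspace_def by blast
  have Zout: "Z i j = {0}" if "j \<notin> {0..int N}" for i j
    using assms(3) that by auto
  have dZ: "Z.bounded_op (Z i j) (Z (i + 1) j) (d i j)"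
    and dd: "x \<in> Z i j \<Longrightarrow> d (i + 1) j (d i j x) = 0" for i j x
    using assms(4)[of j] unfolding bounded_complex_def by blast+
  have mem: "\<phi> j \<in> Z i j" if "\<phi> \<in> sum_space N Z i" for \<phi> i j
    using that Zout by (rule sum_space_mem)
  note zero = Z.bounded_op_zero[OF _ Zsub]
  have Xsub: "subspace (?X i)" for i
    using sum_space_subspace[OF assms(1) Zsub] .
  have KX: "bounded_op (?X i) (?X i) (?K i)" for i
    unfolding shift_op_def[abs_def] using assms(5)[of i "_ + 1"]
    by (intro reindexed_op_bounded[OF assms(1) Zsub]) (simp_all add: Zout)
  have SX: "bounded_op (?X i) (?X (i + 1)) (?S i)" for i
    unfolding shift_op_def[abs_def] using assms(6)[of i "_ + 1"]
    by (intro reindexed_op_bounded[OF assms(1) Zsub]) (simp_all add: Zout)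
  have DX: "bounded_op (?X i) (?X (i + 1)) (?D i)" for i
    using reindexed_op_bounded[OF assms(1) Zsub, where s = 0 and T = "d i" and i = i]
      Zout dZ by (simp add: diag_op_def[abs_def])
  have DVX: "bounded_op (?X i) (?X (i + 1)) (?DV i)" for i
    unfolding twisted_op_def[abs_def] by (rule bounded_op_diff[OF DX SX Xsub])
  have DD: "?D (i + 1) (?D i \<phi>) = 0" if "\<phi> \<in> ?X i" for i \<phi>
    using dd[OF mem[OF that]] by (simp add: diag_op_def fun_eq_iff)
  have SK: "?S i (?K i \<phi>) = ?K (i + 1) (?S i \<phi>)" if "\<phi> \<in> ?X i" for i \<phi>
  proof
    fix j
    show "?S i (?K i \<phi>) j = ?K (i + 1) (?S i \<phi>) j"
      using assms(7)[OF mem[OF that], of "j + 2"] by (simp add: shift_op_def add_ac)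
  qed
  have DK: "?S i \<phi> = ?D i (?K i \<phi>) - ?K (i + 1) (?D i \<phi>)" if "\<phi> \<in> ?X i" for i \<phi>
  proof
    fix j
    show "?S i \<phi> j = (?D i (?K i \<phi>) - ?K (i + 1) (?D i \<phi>)) j"
      using assms(8)[OF mem[OF that], of "j + 1"] by (simp add: shift_op_def diag_op_def)
  qed
  have nil: "(?K i ^^ m) \<phi> = 0" if "\<phi> \<in> ?X i" "N < m" for i m \<phi>
    using bounded_op_mem[OF KX] zero[OF assms(5)] that by (rule shift_op_nilpotent)

  define E where "E i = exp_comb N (?K i)" for i
  define G where "G i = exp_neg_comb N (?K i)" for i
  have EX: "bounded_op (?X i) (?X i) (E i)" and GX: "bounded_op (?X i) (?X i) (G i)" for i
    unfolding E_def G_def by (rule bounded_op_power_comb[OF KX Xsub])+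
  have GE: "G i (E i \<phi>) = \<phi>" and EG: "E i (G i \<phi>) = \<phi>" if "\<phi> \<in> ?X i" for i \<phi>
    unfolding E_def G_def using exp_comb_inverse[OF KX Xsub that] nil[OF that] by blast+
  have ED: "E (i + 1) (?D i \<phi>) = ?DV i (E i \<phi>)" if "\<phi> \<in> ?X i" for i \<phi>
    unfolding E_def twisted_op_def
    by (rule exp_comb_intertwines[OF Xsub Xsub KX KX SX DX _ _ _ _ that])
      (rule SK DK nil lessI | assumption)+
  have exp_E: "exp_op (?K i) \<phi> = E i \<phi>" if "\<phi> \<in> ?X i" for i \<phi>
    unfolding E_def power_comb_def using assms(1) nil[OF that] by (rule exp_op_eq_exp_comb)
  \<comment> \<open>The twisted operator inherits square zero from \<open>?D\<close> by conjugation with \<open>E\<close>.\<close>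
  have DVDV: "?DV (i + 1) (?DV i \<phi>) = 0" if "\<phi> \<in> ?X i" for i \<phi>
  proof -
    have \<psi>: "G i \<phi> \<in> ?X i" using bounded_op_mem[OF GX that] .
    have "?DV (i + 1) (?DV i \<phi>) = ?DV (i + 1) (E (i + 1) (?D i (G i \<phi>)))"
      using ED[OF \<psi>] EG[OF that] by simp
    also have "\<dots> = E (i + 1 + 1) (?D (i + 1) (?D i (G i \<phi>)))"
      using ED[OF bounded_op_mem[OF DX \<psi>]] by simp
    finally show ?thesis using DD[OF \<psi>] bounded_op_zero[OF EX Xsub] by simp
  qed
  have C: "bounded_complex (sum_scale scl) (sum_norm N) ?X ?D"
    and CV: "bounded_complex (sum_scale scl) (sum_norm N) ?X ?DV"
    unfolding bounded_complex_def using DX DD DVX DVDV by blast+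
  have iso: "bounded_complex_iso (sum_scale scl) (sum_norm N) ?X ?D ?DV (\<lambda>i. exp_op (?K i))"
  proof -
    have expX: "bounded_op (?X i) (?X i) (exp_op (?K i))" for i
      using EX Xsub exp_E by (rule bounded_op_cong)
    have bij: "bij_betw (exp_op (?K i)) (?X i) (?X i)" for i
      using bounded_op_mem[OF EX] bounded_op_mem[OF GX]
      by (intro bij_betw_byWitness[where f' = "G i"]) (auto simp: exp_E GE EG)
    have "inv_into (?X i) (exp_op (?K i)) \<phi> = G i \<phi>" if "\<phi> \<in> ?X i" for i \<phi>
      using bij bounded_op_mem[OF GX that] that
      by (intro inv_into_f_eq) (auto simp: bij_betw_def exp_E EG)
    then have invX: "bounded_op (?X i) (?X i) (inv_into (?X i) (exp_op (?K i)))" for i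
      using bounded_op_cong[OF GX Xsub] by blast
    have "exp_op (?K (i + 1)) (?D i \<phi>) = ?DV i (exp_op (?K i) \<phi>)" if "\<phi> \<in> ?X i" for i \<phi>
      using ED[OF that] exp_E[OF that] exp_E[OF bounded_op_mem[OF DX that]] by simp
    then show ?thesis
      unfolding bounded_complex_iso_def using expX bij invX by blast
  qed
  have split: "vs_isomorphic (cohomology (sum_scale scl) ?X ?D k)
      (direct_sum_vspace {0..int N} (\<lambda>j. cohomology scl (\<lambda>i. Z i j) (\<lambda>i. d i j) k))" for k
  proof -
    let ?ker = "\<lambda>i j. {x \<in> Z i j. d i j x = 0}"
    let ?ran = "\<lambda>i j. d (i - 1) j ` Z (i - 1) j"
    have ker: "{\<phi> \<in> ?X k. ?D k \<phi> = 0} = sum_space N ?ker k"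
      using zero[OF dZ] unfolding sum_space_def diag_op_def by (fastforce simp: fun_eq_iff)
    have ran: "?D (k - 1) ` ?X (k - 1) = sum_space N ?ran k"
    proof (intro equalityI subsetI)
      fix \<phi> assume "\<phi> \<in> ?D (k - 1) ` ?X (k - 1)"
      then show "\<phi> \<in> sum_space N ?ran k"
        using zero[OF dZ] unfolding sum_space_def diag_op_def by auto
    next
      fix \<phi> assume \<phi>: "\<phi> \<in> sum_space N ?ran k"
      then have "\<forall>j\<in>{0..int N}. \<exists>z. z \<in> Z (k - 1) j \<and> \<phi> j = d (k - 1) j z"
        unfolding sum_space_def by blast
      then obtain z where z: "\<And>j. j \<in> {0..int N} \<Longrightarrow> z j \<in> Z (k - 1) j \<and> \<phi> j = d (k - 1) j (z j)"
        by metis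
      \<comment> \<open>Preimages chosen row by row, set to zero outside the range of the rows.\<close>
      let ?w = "\<lambda>j. if j \<in> {0..int N} then z j else 0"
      have "?w \<in> ?X (k - 1)" using z by (intro sum_space_memI) auto
      moreover have "\<phi> = ?D (k - 1) ?w"
        using z \<phi> zero[OF dZ] unfolding sum_space_def diag_op_def by (auto simp: fun_eq_iff)
      ultimately show "\<phi> \<in> ?D (k - 1) ` ?X (k - 1)" by blast
    qed
    have "0 \<in> ?ran k j" for j
      using zero[OF dZ] Z.subspace_0[OF Zsub] by (intro image_eqI[where x = 0]) auto
    then show ?thesis
      unfolding cohomology_def ker ran by (intro quotient_of_sum_iso)
  qed
  show ?thesis
    using C CV iso vs_isomorphic_trans[OF cohomology_iso[OF C CV Xsub iso] split] by blast
qed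

end
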